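(* Let $X$ be a unital Banach algebra over $K$ ($K=\mathbb{R}$ or $\mathbb{C}$), with a quasi-product $[\cdot,\cdot]_X$ and maps $g,\gamma:X\to X$ as fixed in the context. Let $F\in B(X)$ be generalized real definite (with respect to $[\cdot,\cdot]_X$ and $g$) with $F(0)=0$. Then there is a bounded interval $[m,M]\subset\mathbb{R}$ depending on $F$ such that for all $x\in X$ $$[F(x),g(x)]_X=\left[\left[\int_m^M\lambda\, d(\gamma\circ E_\lambda)\right](x),\,g(x)\right]_X$$ and $$[F(x),g(x)]_X\equiv\int_m^M\lambda\, dw_x(\lambda),$$ where $w_x(\lambda)=[(\gamma\circ E_\lambda)(x),g(x)]_X$ and the second integral is the ordinary Riemann–Stieltjes integral.
   Context: Spaces are nontrivial. $B(X)$ is the set of all (possibly nonlinear) maps $F:X\to X$ with $\|F\|_{B(X)}:=\max\left(\sup_{x\ne0}\|F(x)\|_X/\|x\|_X,\ \|F(0)\|_X\right)<\infty$; it is a normed space under pointwise operations. A quasi-product on $X$ is a map $[\cdot,\cdot]_X:X\times X\to K$ such that: (a) $[x,x]_X\ge0$ for all $x$; (b) there is $\overline c>0$ with $|[x,y]_X|\le\overline c\|x\|_X\|y\|_X$ for all $x,y$; (c) there is a positive function $c:X\to\mathbb{R}$, bounded and bounded away from $0$, with $[\sum_{i=1}^n\alpha_ix_i,y]_X=c(y)\sum_{i=1}^n\alpha_i[x_i,y]_X$ for all $n\ge1$, $x_i,y\in X$, $\alpha_i\in K$. Fix a quasi-product $[\cdot,\cdot]_X$ and a map $g:X\to X$ with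 $g(x)\neq0$ for $x\ne0$. A map $F:X\to X$ is generalized real definite if $[F(x),g(x)]_X\in\mathbb{R}$ for all $x\in X$, and g-positive if $[F(x),g(x)]_X\ge0$ for all $x\in X$. Fix also a g-positive map $\gamma:X\to X$ with $[\gamma(x),g(x)]_X=k_1(x)\|x\|_X\|g(x)\|_X$ and $\|\gamma(x)\|_X=k_2(x)\|x\|_X$ for all $x$, where $k_1,k_2$ are positive bounded functions bounded away from $0$. For generalized real definite $F$, $|F|(x)=F(x)$ if $[F(x),g(x)]_X\ge0$ and $|F|(x)=-F(x)$ otherwise; $F^+=(|F|+F)/2$. For $\lambda\in\mathbb{R}$, $F_\lambda=F-\lambda\gamma$, and $E_\lambda:X\to X$ is given by $E_\lambda(x)=x$ if $F_\lambda^+(x)=0$ and $E_\lambda(x)=0$ otherwise. For partitions $m=s_0<s_1<\dots<s_n=M$ with $s_j-s_{j-1}<\epsilon_n$, $0<\epsilon_n\to0$, and $\lambda_j\in(s_{j-1},s_j]$, put $E_{\Delta_j}=E_{s_j}-E_{s_{j-1}}$. The operator $\int_m^M\lambda\,d(\gamma\circ E_\lambda)$ denotes the limit in $\|\cdot\|_{B(X)}$, as $n\to\infty$, of $\sum_{j=1}^n\lambda_j(\gamma\circ E_{\Delta_j})$, when it exists independently of the choice of the $\lambda_j$. For functionals $G_1,G_2:X\to K$, $G_1(x)\equiv G_2(x)$ means that there are numbers $\underline k,\overline k>0$ with $\underline k|G_2(x)|\le|G_1(x)|\le\overline k|G_2(x)|$ for all $x\in X$. *)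

theory Defs
  imports "HOL-Analysis.Analysis"
begin

text \<open>
  The scalar field \<open>K\<close> is a type \<open>'k :: real_normed_field\<close>.  By the Gelfand-Mazur theorem the
  fields of this class are, up to isometric isomorphism, exactly the real and the complex numbers;
  \<^typ>\<open>real\<close> and \<^typ>\<open>complex\<close> are its library instances.  The scalar action
  \<open>smul\<close> extends the real one coming from the type class of the algebra, so for real scalars it is
  just \<^const>\<open>scaleR\<close>.  The class \<^class>\<open>real_algebra_1\<close> gives a unit different from \<open>0\<close>
  (so the space is nontrivial); it is not required to have norm \<open>1\<close>.
\<close>

locale unital_banach_algebra = vector_space smul
  for smul :: "'k::real_normed_field \<Rightarrow> 'a::{banach, real_normed_algebra, real_algebra_1} \<Rightarrow> 'a" +
  assumes scale_of_real: "smul (of_real r) x = r *\<^sub>R x"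
    and norm_scale: "norm (smul \<alpha> x) = norm \<alpha> * norm x"
    and scale_mult_left: "smul \<alpha> x * y = smul \<alpha> (x * y)"
    and scale_mult_right: "x * smul \<alpha> y = smul \<alpha> (x * y)"


subsection \<open>The normed space of bounded nonlinear maps\<close>

definition B_maps :: "('a::real_normed_vector \<Rightarrow> 'a) set" where
  "B_maps = {F. bdd_above ((\<lambda>x. norm (F x) / norm x) ` (- {0}))}"

definition B_norm :: "('a::real_normed_vector \<Rightarrow> 'a) \<Rightarrow> real" where
  "B_norm F = max (SUP x\<in>- {0}. norm (F x) / norm x) (norm (F 0))"

definition B_tendsto :: "(nat \<Rightarrow> 'a::real_normed_vector \<Rightarrow> 'a) \<Rightarrow> ('a \<Rightarrow> 'a) \<Rightarrow> bool" where
  "B_tendsto S I \<longleftrightarrow> (\<forall>n. S n \<in> B_maps) \<and> I \<in> B_maps \<and>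
     (\<lambda>n. B_norm (\<lambda>x. S n x - I x)) \<longlonglongrightarrow> 0"


subsection \<open>Quasi-products\<close>

definition bounded_and_bounded_away :: "('a \<Rightarrow> real) \<Rightarrow> bool" where
  "bounded_and_bounded_away k \<longleftrightarrow> (\<exists>a b. 0 < a \<and> (\<forall>x. a \<le> k x \<and> k x \<le> b))"

definition quasi_product ::
  "('k::real_normed_field \<Rightarrow> 'a::real_normed_vector \<Rightarrow> 'a) \<Rightarrow> ('a \<Rightarrow> 'a \<Rightarrow> 'k) \<Rightarrow> bool" where
  "quasi_product smul q \<longleftrightarrow>
     (\<forall>x. q x x \<in> \<real>\<^sub>\<ge>\<^sub>0) \<and>
     (\<exists>C>0. \<forall>x y. norm (q x y) \<le> C * norm x * norm y) \<and>
     (\<exists>c. bounded_and_bounded_away c \<and>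
        (\<forall>n\<ge>1. \<forall>(\<alpha> :: nat \<Rightarrow> 'k) (x :: nat \<Rightarrow> 'a) y.
           q (\<Sum>i=1..n. smul (\<alpha> i) (x i)) y = of_real (c y) * (\<Sum>i=1..n. \<alpha> i * q (x i) y)))"

definition gen_real_definite ::
  "('a \<Rightarrow> 'a \<Rightarrow> 'k::real_normed_field) \<Rightarrow> ('a \<Rightarrow> 'a) \<Rightarrow> ('a \<Rightarrow> 'a) \<Rightarrow> bool" where
  "gen_real_definite q g F \<longleftrightarrow> (\<forall>x. q (F x) (g x) \<in> \<real>)"

definition g_positive ::
  "('a \<Rightarrow> 'a \<Rightarrow> 'k::real_normed_field) \<Rightarrow> ('a \<Rightarrow> 'a) \<Rightarrow> ('a \<Rightarrow> 'a) \<Rightarrow> bool" where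
  "g_positive q g F \<longleftrightarrow> (\<forall>x. q (F x) (g x) \<in> \<real>\<^sub>\<ge>\<^sub>0)"

definition admissible_gamma ::
  "('a::real_normed_vector \<Rightarrow> 'a \<Rightarrow> 'k::real_normed_field) \<Rightarrow> ('a \<Rightarrow> 'a) \<Rightarrow> ('a \<Rightarrow> 'a) \<Rightarrow> bool" where
  "admissible_gamma q g \<gamma> \<longleftrightarrow> g_positive q g \<gamma> \<and>
     (\<exists>k1 k2. bounded_and_bounded_away k1 \<and> bounded_and_bounded_away k2 \<and>
        (\<forall>x. q (\<gamma> x) (g x) = of_real (k1 x * norm x * norm (g x))) \<and>
        (\<forall>x. norm (\<gamma> x) = k2 x * norm x))"


subsection \<open>The spectral family of a map\<close>

definition gen_abs ::
  "('a::real_vector \<Rightarrow> 'a \<Rightarrow> 'k::real_normed_field) \<Rightarrow> ('a \<Rightarrow> 'a) \<Rightarrow> ('a \<Rightarrow> 'a) \<Rightarrow> 'a \<Rightarrow> 'a" where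
  "gen_abs q g F x = (if q (F x) (g x) \<in> \<real>\<^sub>\<ge>\<^sub>0 then F x else - F x)"

definition pos_part ::
  "('a::real_vector \<Rightarrow> 'a \<Rightarrow> 'k::real_normed_field) \<Rightarrow> ('a \<Rightarrow> 'a) \<Rightarrow> ('a \<Rightarrow> 'a) \<Rightarrow> 'a \<Rightarrow> 'a" where
  "pos_part q g F x = (gen_abs q g F x + F x) /\<^sub>R 2"

definition spectral_E ::
  "('a::real_vector \<Rightarrow> 'a \<Rightarrow> 'k::real_normed_field) \<Rightarrow> ('a \<Rightarrow> 'a) \<Rightarrow> ('a \<Rightarrow> 'a) \<Rightarrow> ('a \<Rightarrow> 'a)
    \<Rightarrow> real \<Rightarrow> 'a \<Rightarrow> 'a" where
  "spectral_E q g \<gamma> F l x =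
     (if pos_part q g (\<lambda>y. F y - l *\<^sub>R \<gamma> y) x = 0 then x else 0)"


subsection \<open>Integrals\<close>

definition is_partition :: "real \<Rightarrow> real \<Rightarrow> nat \<Rightarrow> (nat \<Rightarrow> real) \<Rightarrow> bool" where
  "is_partition a b n s \<longleftrightarrow> s 0 = a \<and> s n = b \<and> (\<forall>j\<in>{1..n}. s (j - 1) < s j)"

text \<open>
  In the next definition \<open>E\<close> is a family of maps indexed by \<open>\<lambda>\<close>; \<open>s n\<close> is the \<open>n\<close>-th partition
  \<open>m = s\<^sub>0 < \<dots> < s\<^sub>n = M\<close>, with exactly \<open>n\<close> pieces, and \<open>t n\<close> are the points \<open>\<lambda>\<^sub>j\<close> chosen in it.
  The limit is required to be the same for all sequences of partitions of vanishing mesh and all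
  choices of points.  Note that \<open>\<gamma>\<close> is applied to the difference of values of \<open>E\<close>, and that it
  need not be additive.  There is no partition with \<open>n = 0\<close> pieces if \<open>m < M\<close>.
\<close>

definition has_spectral_integral ::
  "('a::real_normed_vector \<Rightarrow> 'a) \<Rightarrow> (real \<Rightarrow> 'a \<Rightarrow> 'a) \<Rightarrow> real \<Rightarrow> real \<Rightarrow> ('a \<Rightarrow> 'a) \<Rightarrow> bool" where
  "has_spectral_integral \<gamma> E m M I \<longleftrightarrow>
     (\<forall>\<epsilon> s t.
        (\<forall>n. 0 < \<epsilon> n) \<and> \<epsilon> \<longlonglongrightarrow> 0 \<and>
        (\<forall>n\<ge>1. is_partition m M n (s n) \<and>
           (\<forall>j\<in>{1..n}. s n j - s n (j - 1) < \<epsilon> n \<and> t n j \<in> {s n (j - 1)<..s n j}))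
        \<longrightarrow> B_tendsto (\<lambda>n x. \<Sum>j=1..n. t n j *\<^sub>R \<gamma> (E (s n j) x - E (s n (j - 1)) x)) I)"

definition has_RS_integral ::
  "(real \<Rightarrow> real) \<Rightarrow> (real \<Rightarrow> 'b::real_normed_vector) \<Rightarrow> real \<Rightarrow> real \<Rightarrow> 'b \<Rightarrow> bool" where
  "has_RS_integral f w a b J \<longleftrightarrow>
     (\<forall>e>0. \<exists>d>0. \<forall>n s t.
        is_partition a b n s \<and>
        (\<forall>j\<in>{1..n}. s j - s (j - 1) < d \<and> t j \<in> {s (j - 1)..s j})
        \<longrightarrow> norm ((\<Sum>j=1..n. f (t j) *\<^sub>R (w (s j) - w (s (j - 1)))) - J) < e)"

definition functional_equiv :: "('a \<Rightarrow> 'k::real_normed_field) \<Rightarrow> ('a \<Rightarrow> 'k) \<Rightarrow> bool" where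
  "functional_equiv G1 G2 \<longleftrightarrow>
     (\<exists>k K. 0 < k \<and> 0 < K \<and> (\<forall>x. k * norm (G2 x) \<le> norm (G1 x) \<and> norm (G1 x) \<le> K * norm (G2 x)))"

end

theory Submission
  imports Defs
begin

text \<open>
  Taking \<open>n = 1\<close> and \<open>\<alpha>\<^sub>1 = 1\<close> in the quasi-linearity axiom gives \<open>[x, y] = c(y) [x, y]\<close>, so a
  quasi-product is linear in its first argument.  For \<open>x \<noteq> 0\<close> let \<open>r(x)\<close> be the quotient
  \<open>[F(x), g(x)] / [\<gamma>(x), g(x)]\<close>, a bounded real function of \<open>x\<close>.  Then \<open>[F\<^sub>\<lambda>(x), g(x)]\<close> is
  \<open>(r(x) - \<lambda>) [\<gamma>(x), g(x)]\<close>, so \<open>E\<^sub>\<lambda>(x)\<close> is \<open>0\<close> for \<open>\<lambda> < r(x)\<close> and \<open>x\<close> for \<open>\<lambda> > r(x)\<close>.  In every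
  sum only the cell of the partition in which this jump happens contributes, and it contributes
  \<open>\<lambda>\<^sub>j \<gamma>(x)\<close> with \<open>\<lambda>\<^sub>j\<close> close to \<open>r(x)\<close>, uniformly in \<open>x\<close>.  So the spectral integral is the map
  \<open>r \<gamma>\<close>, and both sides of the second claim are even equal.
\<close>

section \<open>Linearity of a quasi-product in its first argument\<close>

lemma quasi_product_linear:
  assumes "vector_space smul" and "quasi_product smul q"
  shows "q (smul a x + smul b z) y = a * q x y + b * q z y"
proof -
  interpret vector_space smul by fact
  obtain c where c: "\<And>n \<alpha> (x :: nat \<Rightarrow> 'b) y. n \<ge> 1 \<Longrightarrow>
      q (\<Sum>i=1..n. smul (\<alpha> i) (x i)) y = of_real (c y) * (\<Sum>i=1..n. \<alpha> i * q (x i) y)"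
    using assms(2) unfolding quasi_product_def by blast
  have c1: "q u y = of_real (c y) * q u y" for u
    using c[of 1 "\<lambda>_. 1" "\<lambda>_. u" y] by simp
  have "q (smul a x + smul b z) y = of_real (c y) * (a * q x y + b * q z y)"
    using c[of 2 "\<lambda>i. if i = 1 then a else b" "\<lambda>i. if i = 1 then x else z" y]
    by (simp add: numeral_2_eq_2)
  \<comment> \<open>The factor is distributed so that each summand can absorb its own copy by
    \<open>c1\<close>.\<close>
  also have "\<dots> = a * (of_real (c y) * q x y) + b * (of_real (c y) * q z y)"
    by (simp add: algebra_simps)
  finally show ?thesis
    using c1 by simp
qed

section \<open>Sums over partitions against an integrator with a single jump\<close>

lemma is_partition_less:
  assumes "is_partition a b n s" and "i < j" and "j \<le> n"
  shows "s i < s j"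
  using assms(2,3)
proof (induction j)
  case (Suc j)
  have "s j < s (Suc j)"
    using assms(1) Suc.prems unfolding is_partition_def by (auto dest: bspec[of _ _ "Suc j"])
  then show ?case
    using Suc by (cases "i = j") auto
qed simp

text \<open>The cell is the one whose right end is the first partition point satisfying
  \<open>P\<close>. That point is at least \<open>r\<close>, so strict monotonicity puts all later
  points above \<open>r\<close>. Nothing is assumed about \<open>P r\<close>, so \<open>r\<close>
  may itself be a partition point.\<close>

lemma is_partition_jump_cell:
  assumes part: "is_partition a b n s" and r: "a < r" "r < b"
    and below: "\<And>l. l < r \<Longrightarrow> \<not> P l" and above: "\<And>l. r < l \<Longrightarrow> P l"
  obtains j where "j \<in> {1..n}" "s (j - 1) \<le> r" "r \<le> s j" "P (s j)" "\<not> P (s (j - 1))"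
    "\<And>i. i \<in> {1..n} \<Longrightarrow> i \<noteq> j \<Longrightarrow> P (s i) = P (s (i - 1))"
proof -
  define j where "j = (LEAST j. P (s j))"
  have ends: "s 0 = a" "s n = b"
    using part by (auto simp: is_partition_def)
  have "P (s n)"
    using ends above r by simp
  then have Pj: "P (s j)" and "j \<le> n"
    unfolding j_def by (auto intro: LeastI Least_le)
  have nP: "\<not> P (s i)" if "i < j" for i
    using that not_less_Least unfolding j_def by blast
  have P: "P (s i)" if "j \<le> i" "i \<le> n" for i
  proof (cases "i = j")
    case False
    then have "s j < s i"
      using is_partition_less[OF part] that by simp
    moreover have "r \<le> s j"
      using Pj below by force
    ultimately show ?thesis
      using above by simp
  qed (use Pj in simp)
  have "j \<noteq> 0"
    using Pj ends below r by metis
  show thesis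
  proof
    show "j \<in> {1..n}" "P (s j)" "\<not> P (s (j - 1))"
      using \<open>j \<noteq> 0\<close> \<open>j \<le> n\<close> Pj nP by auto
    then show "s (j - 1) \<le> r" "r \<le> s j"
      using above below by force+
    show "P (s i) = P (s (i - 1))" if "i \<in> {1..n}" "i \<noteq> j" for i
    proof (cases "i < j")
      case True
      then show ?thesis using nP by simp
    next
      case False
      then show ?thesis using that P by auto
    qed
  qed
qed

text \<open>Only the jump cell survives, and there the tag and \<open>r\<close> lie in one closed
  interval shorter than \<open>d\<close>. The increment is an arbitrary \<open>\<phi>\<close> of the
  truth values at the right and left ends, which covers both \<open>\<gamma>\<close> of a difference
  and a difference of values of \<open>w_x\<close>.\<close>

lemma jump_sum_estimate:
  fixes \<phi> :: "bool \<Rightarrow> bool \<Rightarrow> 'b::real_normed_vector"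
  assumes part: "is_partition a b n s" and r: "a < r" "r < b"
    and P: "\<And>l. l < r \<Longrightarrow> \<not> P l" "\<And>l. r < l \<Longrightarrow> P l"
    and \<phi>: "\<And>p. \<phi> p p = 0"
    and tags: "\<And>i. i \<in> {1..n} \<Longrightarrow> s i - s (i - 1) < d \<and> t i \<in> {s (i - 1)..s i}"
  shows "norm ((\<Sum>i=1..n. t i *\<^sub>R \<phi> (P (s i)) (P (s (i - 1)))) - r *\<^sub>R \<phi> True False)
    \<le> d * norm (\<phi> True False)"
proof -
  obtain j where j: "j \<in> {1..n}" "s (j - 1) \<le> r" "r \<le> s j" "P (s j)" "\<not> P (s (j - 1))"
    and other: "\<And>i. i \<in> {1..n} \<Longrightarrow> i \<noteq> j \<Longrightarrow> P (s i) = P (s (i - 1))"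
    using is_partition_jump_cell[where P = P, OF part r P] by blast
  have "(\<Sum>i=1..n. t i *\<^sub>R \<phi> (P (s i)) (P (s (i - 1))))
      = (\<Sum>i\<in>{j}. t i *\<^sub>R \<phi> (P (s i)) (P (s (i - 1))))"
    using j(1) other \<phi> by (intro sum.mono_neutral_right) auto
  also have "\<dots> - r *\<^sub>R \<phi> True False = (t j - r) *\<^sub>R \<phi> True False"
    using j by (simp add: scaleR_left_diff_distrib)
  also have "norm \<dots> \<le> d * norm (\<phi> True False)"
    using tags[OF j(1)] j(2,3) by (auto intro!: mult_right_mono)
  finally show ?thesis by simp
qed

section \<open>Linear growth bounds and the norm of bounded maps\<close>

lemma B_maps_bound:
  assumes "F \<in> B_maps" and "F 0 = 0"
  obtains B where "0 \<le> B" "\<And>x. norm (F x) \<le> B * norm x"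
proof -
  obtain B where B: "\<And>x. x \<noteq> 0 \<Longrightarrow> norm (F x) / norm x \<le> B"
    using assms(1) unfolding B_maps_def bdd_above_def by auto
  have "norm (F x) \<le> max B 0 * norm x" for x
  proof (cases "x = 0")
    case False
    then have "norm (F x) / norm x \<le> max B 0"
      using B[of x] by simp
    then show ?thesis
      using False by (simp add: divide_le_eq)
  qed (use assms(2) in simp)
  then show thesis
    by (rule that[rotated]) simp
qed

lemma B_mapsI:
  assumes "\<And>x. norm (F x) \<le> B * norm x"
  shows "F \<in> B_maps"
  unfolding B_maps_def bdd_above_def using assms by (auto intro!: exI[of _ B] simp: divide_le_eq)

lemma B_norm_le:
  fixes F :: "'a::{real_normed_vector, zero_neq_one} \<Rightarrow> 'a"
  assumes "\<And>x. norm (F x) \<le> B * norm x" and "0 \<le> B"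
  shows "B_norm F \<le> B"
proof -
  have "(SUP x\<in>- {0}. norm (F x) / norm x) \<le> B"
  proof (rule cSUP_least)
    \<comment> \<open>The unit is a nonzero vector, so the supremum is over a nonempty set.\<close>
    show "- {0 :: 'a} \<noteq> {}"
      by (metis Compl_iff empty_iff singletonD zero_neq_one)
  qed (use assms in \<open>auto simp: divide_le_eq\<close>)
  then show ?thesis
    using assms(1)[of 0] assms(2) by (simp add: B_norm_def)
qed

lemma B_norm_nonneg: "0 \<le> B_norm F"
  unfolding B_norm_def by (simp add: le_max_iff_disj)

section \<open>The spectral family at a fixed vector\<close>

lemma spectral_E_jump:
  fixes q :: "'a::real_vector \<Rightarrow> 'a \<Rightarrow> 'k::real_normed_field"
  assumes lin: "\<And>a b x z y. q (a *\<^sub>R x + b *\<^sub>R z) y = of_real a * q x y + of_real b * q z y"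
    and F: "q (F x) (g x) = of_real (r * \<kappa>)"
    and \<gamma>: "q (\<gamma> x) (g x) = of_real \<kappa>" and "0 < \<kappa>"
  shows "l < r \<Longrightarrow> spectral_E q g \<gamma> F l x = 0" and "r < l \<Longrightarrow> spectral_E q g \<gamma> F l x = x"
proof -
  define y where "y = F x - l *\<^sub>R \<gamma> x"
  have "q y (g x) = of_real 1 * q (F x) (g x) + of_real (- l) * q (\<gamma> x) (g x)"
    unfolding y_def lin[symmetric] by simp
  then have q: "q y (g x) = of_real ((r - l) * \<kappa>)"
    by (simp add: F \<gamma> algebra_simps)
  \<comment> \<open>At \<open>l = r\<close> the product vanishes but \<open>y\<close> need not, so
    the value of the spectral family there stays undetermined.\<close>
  have pp: "pos_part q g (\<lambda>z. F z - l *\<^sub>R \<gamma> z) x = (if l \<le> r then y else 0)"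
    using \<open>0 < \<kappa>\<close>
    by (simp add: pos_part_def gen_abs_def q[unfolded y_def] y_def zero_le_mult_iff
        flip: scaleR_2 del: of_real_mult)
  show "spectral_E q g \<gamma> F l x = x" if "r < l"
    using that by (simp add: spectral_E_def pp)
  have "q 0 (g x) = 0"
    using lin[of 0 0 0 0 "g x"] by simp
  then have "y \<noteq> 0" if "l < r"
    using q that \<open>0 < \<kappa>\<close> by force
  then show "spectral_E q g \<gamma> F l x = 0" if "l < r"
    using that by (simp add: spectral_E_def pp)
qed

section \<open>Existence and values of the two integrals\<close>

theorem theorem3p21:
  fixes smul :: "'k::real_normed_field \<Rightarrow> 'a::{banach, real_normed_algebra, real_algebra_1} \<Rightarrow> 'a"
    and q :: "'a \<Rightarrow> 'a \<Rightarrow> 'k"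
    and g \<gamma> F :: "'a \<Rightarrow> 'a"
  assumes "unital_banach_algebra smul"
    and "quasi_product smul q"
    and "\<And>x. x \<noteq> 0 \<Longrightarrow> g x \<noteq> 0"
    and "admissible_gamma q g \<gamma>"
    and "F \<in> B_maps"
    and "gen_real_definite q g F"
    and "F 0 = 0"
  shows "\<exists>m M. m < M \<and>
    (\<exists>I. has_spectral_integral \<gamma> (spectral_E q g \<gamma> F) m M I \<and>
      (\<forall>x. q (F x) (g x) = q (I x) (g x))) \<and>
    (\<exists>J. (\<forall>x. has_RS_integral (\<lambda>l. l) (\<lambda>l. q (\<gamma> (spectral_E q g \<gamma> F l x)) (g x)) m M (J x)) \<and>
      functional_equiv (\<lambda>x. q (F x) (g x)) J)"
proof -
  interpret unital_banach_algebra smul by fact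
  have lin: "q (a *\<^sub>R x + b *\<^sub>R z) y = of_real a * q x y + of_real b * q z y" for a b x z y
    using quasi_product_linear[OF vector_space_axioms assms(2), of "of_real a" x "of_real b"]
    by (simp add: scale_of_real)
  have q0: "q 0 y = 0" for y
    using lin[of 0 0 0 0 y] by simp
  have q_scaleR: "q (a *\<^sub>R x) y = of_real a * q x y" for a x y
    using lin[of a x 0 0 y] by simp
  obtain C where C: "0 < C" "\<And>x y. norm (q x y) \<le> C * norm x * norm y"
    using assms(2) unfolding quasi_product_def by blast
  obtain k1 k2 where k: "bounded_and_bounded_away k1" "bounded_and_bounded_away k2"
    and q\<gamma>: "\<And>x. q (\<gamma> x) (g x) = of_real (k1 x * norm x * norm (g x))"
    and norm\<gamma>: "\<And>x. norm (\<gamma> x) = k2 x * norm x"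
    using assms(4) unfolding admissible_gamma_def by blast
  obtain a1 where a1: "0 < a1" "\<And>x. a1 \<le> k1 x"
    using k(1) unfolding bounded_and_bounded_away_def by blast
  obtain b2 where b2: "0 < b2" "\<And>x. k2 x \<le> b2"
    using k(2) unfolding bounded_and_bounded_away_def by (meson order_less_le_trans)
  have \<gamma>_le: "norm (\<gamma> x) \<le> b2 * norm x" for x
    using b2 by (simp add: norm\<gamma> mult_right_mono)
  \<comment> \<open>Needed because every cell without a jump contributes a multiple of
    \<open>\<gamma> 0\<close>.\<close>
  then have \<gamma>0: "\<gamma> 0 = 0"
    by (metis mult_zero_right norm_le_zero_iff norm_zero)
  obtain B where B: "0 \<le> B" "\<And>x. norm (F x) \<le> B * norm x"
    using B_maps_bound assms(5,7) by blast
  have "\<forall>x. \<exists>v. q (F x) (g x) = of_real v"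
    using assms(6) unfolding gen_real_definite_def Reals_def by blast
  then obtain v where v: "\<And>x. q (F x) (g x) = of_real (v x)"
    by metis

  define \<kappa> where "\<kappa> x = k1 x * norm x * norm (g x)" for x
  \<comment> \<open>Since \<open>\<kappa> 0 = 0\<close>, division by zero gives
    \<open>r 0 = 0\<close>. The bound \<open>R\<close> is the quotient of the upper bound
    \<open>C * B\<close> for the numerator and the lower bound \<open>a1\<close> for the
    denominator, both relative to \<open>norm x * norm (g x)\<close>.\<close>
  define r where "r x = v x / \<kappa> x" for x
  define R where "R = C * B / a1"
  have \<kappa>_pos: "0 < \<kappa> x" if "x \<noteq> 0" for x
    using that a1 order_less_le_trans[OF a1] assms(3) by (simp add: \<kappa>_def)
  have Fr: "q (F x) (g x) = of_real (r x * \<kappa> x)" for x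
  proof (cases "x = 0")
    case True
    then show ?thesis by (simp add: assms(7) q0 \<kappa>_def)
  next
    case False
    then show ?thesis using \<kappa>_pos[OF False] by (simp add: v r_def)
  qed
  have "0 \<le> R"
    using a1 B C by (simp add: R_def)
  have r_le: "\<bar>r x\<bar> \<le> R" for x
  proof (cases "x = 0")
    case True
    then show ?thesis using \<open>0 \<le> R\<close> by (simp add: r_def \<kappa>_def)
  next
    case False
    have "\<bar>v x\<bar> = norm (q (F x) (g x))"
      by (simp add: v)
    also have "\<dots> \<le> C * (B * norm x) * norm (g x)"
      using C B by (meson order_trans mult_right_mono mult_left_mono norm_ge_zero less_imp_le)
    also have "\<dots> = R * (a1 * norm x * norm (g x))"
      using a1 by (simp add: R_def)
    also have "\<dots> \<le> R * \<kappa> x"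
      unfolding \<kappa>_def using a1 \<open>0 \<le> R\<close> by (intro mult_left_mono mult_right_mono) auto
    finally show ?thesis
      using \<kappa>_pos[OF False] by (simp add: r_def divide_le_eq)
  qed

  have "\<exists>P. (\<forall>l. spectral_E q g \<gamma> F l x = (if P l then x else 0)) \<and>
      (\<forall>l<r x. \<not> P l) \<and> (\<forall>l>r x. P l)" for x
  proof (cases "x = 0")
    case True
    \<comment> \<open>For \<open>x = 0\<close> both branches agree, so any predicate with its
      threshold at \<open>r x\<close> will do; the condition that the family fixes \<open>x\<close>
      would hold for every \<open>l\<close>.\<close>
    then show ?thesis
      by (intro exI[of _ "\<lambda>l. r x < l"]) (auto simp: spectral_E_def)
  next
    case False
    note E = spectral_E_jump[of q F x g "r x" "\<kappa> x" \<gamma>, OF lin Fr q\<gamma>[folded \<kappa>_def] \<kappa>_pos[OF False]]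
    show ?thesis
      using False E by (intro exI[of _ "\<lambda>l. spectral_E q g \<gamma> F l x = x"])
        (auto simp: spectral_E_def)
  qed
  then obtain P where P: "\<And>x l. spectral_E q g \<gamma> F l x = (if P x l then x else 0)"
    "\<And>x l. l < r x \<Longrightarrow> \<not> P x l" "\<And>x l. r x < l \<Longrightarrow> P x l"
    by metis

  \<comment> \<open>The margin 1 puts every jump strictly inside one interval that does not depend
    on \<open>x\<close>, even if \<open>R = 0\<close>.\<close>
  define m where "m = - R - 1"
  define M where "M = R + 1"
  have r_in: "m < r x" "r x < M" for x
    using r_le[of x] by (auto simp: m_def M_def)
  define I where "I x = r x *\<^sub>R \<gamma> x" for x
  have I_le: "norm (I x) \<le> R * b2 * norm x" for x
    using mult_mono[OF r_le[of x] \<gamma>_le[of x]] \<open>0 \<le> R\<close> by (simp add: I_def mult.assoc)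

  have "has_spectral_integral \<gamma> (spectral_E q g \<gamma> F) m M I"
    unfolding has_spectral_integral_def
  proof (intro allI impI, elim conjE)
    fix \<epsilon> s t
    assume \<epsilon>: "\<forall>n. 0 < \<epsilon> n" "\<epsilon> \<longlonglongrightarrow> (0::real)"
      and parts: "\<forall>n\<ge>1. is_partition m M n (s n) \<and>
        (\<forall>j\<in>{1..n}. s n j - s n (j - 1) < \<epsilon> n \<and> t n j \<in> {s n (j - 1)<..s n j})"
    define S where "S n x =
      (\<Sum>j=1..n. t n j *\<^sub>R \<gamma> (spectral_E q g \<gamma> F (s n j) x - spectral_E q g \<gamma> F (s n (j - 1)) x))"
      for n x
    have S: "norm (S n x - I x) \<le> \<epsilon> n * b2 * norm x" if "n \<ge> 1" for n x
    proof -
      define \<phi> where "\<phi> p p' = \<gamma> ((if p then x else 0) - (if p' then x else 0))" for p p'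
      have "norm ((\<Sum>i=1..n. t n i *\<^sub>R \<phi> (P x (s n i)) (P x (s n (i - 1)))) - r x *\<^sub>R \<phi> True False)
          \<le> \<epsilon> n * norm (\<phi> True False)"
        using parts that r_in[of x] P(2,3)[where x = x] \<gamma>0
        by (intro jump_sum_estimate[of m M]) (auto simp: \<phi>_def intro: less_imp_le)
      also have "\<dots> \<le> \<epsilon> n * (b2 * norm x)"
        using \<epsilon>(1) \<gamma>_le[of x] by (intro mult_left_mono) (auto simp: \<phi>_def less_imp_le)
      finally show ?thesis
        by (simp add: S_def I_def P(1) \<phi>_def mult.assoc)
    qed
    have "S n \<in> B_maps" for n
    \<comment> \<open>The partition hypotheses start at \<open>n = 1\<close>; the sum for
      \<open>n = 0\<close> is empty.\<close>
    proof (cases "n = 0")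
      case True
      then show ?thesis by (intro B_mapsI[of _ 0]) (simp add: S_def)
    next
      case False
      show ?thesis
      proof (rule B_mapsI)
        show "norm (S n x) \<le> (\<epsilon> n * b2 + R * b2) * norm x" for x
          using S[of n x] False I_le[of x] norm_triangle_sub[of "S n x" "I x"]
          by (simp add: distrib_right)
      qed
    qed
    moreover have "I \<in> B_maps"
      using I_le by (rule B_mapsI)
    moreover have "(\<lambda>n. B_norm (\<lambda>x. S n x - I x)) \<longlonglongrightarrow> 0"
    proof (rule tendsto_sandwich[of "\<lambda>_. 0"])
      show "\<forall>\<^sub>F n in sequentially. B_norm (\<lambda>x. S n x - I x) \<le> \<epsilon> n * b2"
        using eventually_ge_at_top[of 1]
      proof eventually_elim
        case (elim n)
        then show ?case
          using S \<epsilon>(1) b2 by (intro B_norm_le) (auto simp: less_imp_le)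
      qed
      show "(\<lambda>n. \<epsilon> n * b2) \<longlonglongrightarrow> 0"
        using tendsto_mult_left_zero[OF \<epsilon>(2)] .
    qed (simp_all add: B_norm_nonneg)
    ultimately show "B_tendsto (\<lambda>n x. \<Sum>j=1..n. t n j *\<^sub>R
        \<gamma> (spectral_E q g \<gamma> F (s n j) x - spectral_E q g \<gamma> F (s n (j - 1)) x)) I"
      unfolding B_tendsto_def S_def by blast
  qed
  moreover have "q (F x) (g x) = q (I x) (g x)" for x
    by (simp add: Fr I_def q_scaleR q\<gamma> \<kappa>_def)
  moreover have "has_RS_integral (\<lambda>l. l) (\<lambda>l. q (\<gamma> (spectral_E q g \<gamma> F l x)) (g x)) m M
      (q (F x) (g x))" for x
    unfolding has_RS_integral_def
  proof (intro allI impI)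
    fix e :: real assume "0 < e"
    define \<phi> where "\<phi> p p' = q (\<gamma> (if p then x else 0)) (g x) - q (\<gamma> (if p' then x else 0)) (g x)"
      for p p'
    \<comment> \<open>Adding 1 avoids division by zero and makes the final estimate strict. Unlike
      in the spectral integral, \<open>d\<close> may depend on \<open>x\<close>.\<close>
    define d where "d = e / (norm (\<phi> True False) + 1)"
    have pos: "0 < norm (\<phi> True False) + 1"
      by (simp add: add_nonneg_pos)
    have d: "0 < d" "d * norm (\<phi> True False) < e"
      using \<open>0 < e\<close> pos by (simp_all add: d_def divide_less_eq)
    have lim: "r x *\<^sub>R \<phi> True False = q (F x) (g x)"
      by (simp add: \<phi>_def \<gamma>0 q0 Fr q\<gamma> \<kappa>_def scaleR_conv_of_real)
    have "norm ((\<Sum>j=1..n. t j *\<^sub>R (q (\<gamma> (spectral_E q g \<gamma> F (s j) x)) (g x)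
          - q (\<gamma> (spectral_E q g \<gamma> F (s (j - 1)) x)) (g x))) - q (F x) (g x)) < e"
      if "is_partition m M n s"
        and "\<forall>j\<in>{1..n}. s j - s (j - 1) < d \<and> t j \<in> {s (j - 1)..s j}" for n s t
    proof -
      have "norm ((\<Sum>i=1..n. t i *\<^sub>R \<phi> (P x (s i)) (P x (s (i - 1)))) - r x *\<^sub>R \<phi> True False)
          \<le> d * norm (\<phi> True False)"
        using that r_in[of x] P(2,3)[where x = x]
        by (intro jump_sum_estimate[of m M]) (auto simp: \<phi>_def)
      then show ?thesis
        using d(2) unfolding lim by (simp add: P(1) \<phi>_def)
    qed
    then show "\<exists>d>0. \<forall>n s t. is_partition m M n s \<and>
        (\<forall>j\<in>{1..n}. s j - s (j - 1) < d \<and> t j \<in> {s (j - 1)..s j}) \<longrightarrow>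
        norm ((\<Sum>j=1..n. t j *\<^sub>R (q (\<gamma> (spectral_E q g \<gamma> F (s j) x)) (g x)
          - q (\<gamma> (spectral_E q g \<gamma> F (s (j - 1)) x)) (g x))) - q (F x) (g x)) < e"
      using d(1) by blast
  qed
  \<comment> \<open>The Riemann-Stieltjes integral equals the left side, so both constants can be
    1.\<close>
  moreover have "functional_equiv (\<lambda>x. q (F x) (g x)) (\<lambda>x. q (F x) (g x))"
    unfolding functional_equiv_def by (intro exI[of _ 1]) simp
  moreover have "m < M"
    using r_in less_trans by blast
  ultimately show ?thesis
    by (intro exI[of _ m] exI[of _ M] conjI exI[of _ I] exI[of _ "\<lambda>x. q (F x) (g x)"]) auto
qed

end
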